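(* Let $0\le v_1<\cdots<v_n$ be real numbers, $v=(v_1,\ldots,v_n)$, let $J\subset\{1,\ldots,n\}$ with $1\le |J|\le n-4$, let $a_j\neq 0$ be real for $j\in J$, and let $\alpha\in\mathbb{R}$. Let $J_+=\{j\in J: a_j>0\}$ and $J_-=\{j\in J: a_j<0\}$, and let $S$ be the set of $J$-circuits that are undominated with respect to $(J_+,J_-)$. If every $J$-circuit in $S$ satisfies $$\sum_{j\in J}a_jx_j\ge\alpha,$$ and at least $|J|$ affinely independent $J$-circuits satisfy $$\sum_{j\in J}a_jx_j=\alpha,$$ then the inequality $\sum_{j\in J}a_jx_j\ge\alpha$ defines a facet of $H_n(v)$.
   Context: A point $x=(x_1,\ldots,x_n)\in\{v_1,\ldots,v_n\}^n$ is a circuit if the map $\sigma$ on $\{1,\ldots,n\}$ defined by $x_i=v_{\sigma(i)}$ is a permutation consisting of a single $n$-cycle. The hamiltonian circuit polytope $H_n(v)\subset\mathbb{R}^n$ is the convex hull of all circuits. An inequality defines a facet of $H_n(v)$ if it is satisfied by all points of $H_n(v)$ and the set of points of $H_n(v)$ satisfying it at equality is a face of dimension $\dim H_n(v)-1$. For $J\subset\{1,\ldots,n\}$, a $J$-circuit is a tuple $x(J)=(x_j)_{j\in J}$ of pairwise distinct values from $\{v_1,\ldots,v_n\}$ that creates no cycle: there are no $k\ge 1$ and distinct $i_1,\ldots,i_k\in J$ with $x_{i_t}=v_{i_{t+1}}$ for $t=1,\ldots,k-1$ and $x_{i_k}=v_{i_1}$. For a partition $(J_+,J_-)$ of $J$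 (parts may be empty), $x(J)$ dominates $y(J)$ with respect to $(J_+,J_-)$ if $x_j\le y_j$ for all $j\in J_+$ and $x_j\ge y_j$ for all $j\in J_-$. A $J$-circuit is undominated with respect to $(J_+,J_-)$ if no other $J$-circuit dominates it with respect to $(J_+,J_-)$. *)

theory Defs
  imports "HOL-Analysis.Analysis" "HOL-Combinatorics.Orbits"
begin

text \<open>
  The index set \<open>{1, \<dots>, n}\<close> is a finite linearly ordered type \<open>'n\<close> with \<open>n = CARD('n)\<close>. It indexes
  both the coordinates and the values \<open>v $ i\<close>.
\<close>

definition circuit :: "real ^ 'n \<Rightarrow> real ^ 'n \<Rightarrow> bool" where
  "circuit v x \<longleftrightarrow>
     (\<exists>\<sigma>. \<sigma> permutes UNIV \<and> cyclic_on \<sigma> UNIV \<and> (\<forall>i. x $ i = v $ \<sigma> i))"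

definition circuit_polytope :: "real ^ 'n \<Rightarrow> (real ^ 'n) set" where
  "circuit_polytope v = convex hull {x. circuit v x}"

text \<open>
  A tuple \<open>(x\<^sub>j)\<close> with \<open>j \<in> J\<close> is represented by the vector that vanishes off \<open>J\<close>. This is the
  linear embedding of the \<open>J\<close>-indexed tuples into the full space, so distinctness and affine
  independence of tuples are those of the representing vectors. The list \<open>p\<close> is the sequence
  \<open>i\<^sub>1, \<dots>, i\<^sub>k\<close> of a cycle.
\<close>

definition J_circuit :: "real ^ 'n \<Rightarrow> 'n set \<Rightarrow> real ^ 'n \<Rightarrow> bool" where
  "J_circuit v J x \<longleftrightarrow>
     (\<forall>j. j \<notin> J \<longrightarrow> x $ j = 0) \<and>
     (\<forall>j\<in>J. \<exists>i. x $ j = v $ i) \<and>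
     inj_on (\<lambda>j. x $ j) J \<and>
     \<not> (\<exists>p. p \<noteq> [] \<and> distinct p \<and> set p \<subseteq> J \<and>
          (\<forall>t. Suc t < length p \<longrightarrow> x $ (p ! t) = v $ (p ! Suc t)) \<and>
          x $ last p = v $ hd p)"

definition dominates :: "'n set \<Rightarrow> 'n set \<Rightarrow> real ^ 'n \<Rightarrow> real ^ 'n \<Rightarrow> bool" where
  "dominates Jp Jm x y \<longleftrightarrow> (\<forall>j\<in>Jp. x $ j \<le> y $ j) \<and> (\<forall>j\<in>Jm. x $ j \<ge> y $ j)"

definition undominated ::
    "real ^ 'n \<Rightarrow> 'n set \<Rightarrow> 'n set \<Rightarrow> 'n set \<Rightarrow> real ^ 'n \<Rightarrow> bool" where
  "undominated v J Jp Jm x \<longleftrightarrow>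
     J_circuit v J x \<and>
     \<not> (\<exists>y. J_circuit v J y \<and> y \<noteq> x \<and> dominates Jp Jm y x)"

text \<open>
  The inequality is \<open>f x \<ge> \<alpha>\<close>. Unlike the bare dimension condition, \<open>facet_of\<close> excludes the
  empty face; the two differ only for a polytope \<open>P\<close> of dimension \<open>0\<close>.
\<close>

definition defines_facet :: "('a::euclidean_space \<Rightarrow> real) \<Rightarrow> real \<Rightarrow> 'a set \<Rightarrow> bool" where
  "defines_facet f \<alpha> P \<longleftrightarrow> (\<forall>x\<in>P. f x \<ge> \<alpha>) \<and> {x\<in>P. f x = \<alpha>} facet_of P"

end

theory Submission
  imports Defs "HOL-Combinatorics.Cycles"
begin

text \<open>
  The inequality is valid because a minimiser of the left-hand side over the finitely many
  \<open>J\<close>-circuits is undominated: as all \<open>a\<^sub>j\<close> are nonzero, a different \<open>J\<close>-circuit dominating it would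
  have a strictly smaller value. A circuit restricts to a \<open>J\<close>-circuit because \<open>J\<close> is proper.

  For the facet property, the dimension count is replaced by its dual form (\<open>facet_by_functionals\<close>):
  every affine equation \<open>c \<bullet> x = \<gamma>\<close> holding on the face must agree on the whole polytope with a
  multiple of the given equation. Two observations determine \<open>c\<close>.

  First, \<open>c\<close> is constant off \<open>J\<close> (\<open>functional_constant_on_extensions\<close>). A tight \<open>J\<close>-circuit cuts the
  index set into vertex-disjoint paths, one ending at each index outside \<open>J\<close>, hence at least four.
  Concatenating these paths in any order gives a circuit that extends the \<open>J\<close>-circuit and so lies
  on the face. With all but three of the paths glued into one block, the six cyclic orders of the
  four blocks give three equations which, the values \<open>v\<^sub>i\<close> being distinct, force the coefficients
  to agree. With \<open>J\<close> empty the same lemma shows that the face is not the whole polytope.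

  Secondly, all circuits have the same coordinate sum, so a multiple of the all-ones vector may be
  subtracted from \<open>c\<close> to make it vanish off \<open>J\<close>. What remains is constant on \<open>card J\<close> affinely
  independent tuples on which \<open>a\<close> is constant too, and is therefore a multiple of \<open>a\<close>
  (\<open>functional_proportional\<close>).
\<close>

section \<open>Cyclic permutations and path sums\<close>

text \<open>
  The permutation is \<open>cycle_of_list L\<close>; its powers rotate the list, so the orbit of the
  head consists of all entries.
\<close>

lemma cyclic_permutation_of_list:
  assumes "distinct L" "L \<noteq> []"
  obtains \<sigma> where "\<sigma> permutes set L" "cyclic_on \<sigma> (set L)"
    "successively (\<lambda>x y. \<sigma> x = y) L" "\<sigma> (last L) = hd L"
proof -
  let ?\<sigma> = "cycle_of_list L"
  have map_rot: "map (?\<sigma> ^^ k) L = rotate k L" for k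
    by (rule cyclic_rotation[OF assms(1)])
  have pow: "(?\<sigma> ^^ k) (hd L) = L ! (k mod length L)" for k
  proof -
    have "(?\<sigma> ^^ k) (hd L) = hd (rotate k L)"
      using map_rot[of k] assms(2) by (metis hd_map)
    then show ?thesis using assms(2) by (simp add: hd_rotate_conv_nth)
  qed
  have perm: "?\<sigma> permutes set L" by (rule cycle_permutes)
  have step: "?\<sigma> (L ! i) = L ! (Suc i mod length L)" if "i < length L" for i
    using pow[of "Suc i"] pow[of i] that by simp
  have "orbit ?\<sigma> (hd L) = set L"
  proof -
    have "L ! i \<in> orbit ?\<sigma> (hd L)" if "i < length L" for i
    proof -
      \<comment> \<open>An orbit collects only positive powers, so the entry at position 0 needs one full turn.\<close>
      have "L ! i = (?\<sigma> ^^ (i + length L)) (hd L)" using pow[of "i + length L"] that by simp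
      then show ?thesis using assms(2) unfolding orbit_altdef
        by (metis (mono_tags, lifting) add_gr_0 length_greater_0_conv mem_Collect_eq)
    qed
    moreover have "(?\<sigma> ^^ k) (hd L) \<in> set L" for k
      using pow[of k] assms(2) by simp
    ultimately show ?thesis unfolding orbit_altdef by (auto simp: in_set_conv_nth)
  qed
  then have "cyclic_on ?\<sigma> (set L)"
    using assms(2) by (metis cyclic_on_singleI hd_in_set)
  moreover have "successively (\<lambda>x y. ?\<sigma> x = y) L"
    unfolding successively_conv_nth using step by auto
  moreover have "?\<sigma> (last L) = hd L"
    using step[of "length L - 1"] assms(2) by (simp add: last_conv_nth hd_conv_nth)
  ultimately show thesis using perm that by blast
qed

fun path_sum :: "('a \<Rightarrow> 'a \<Rightarrow> real) \<Rightarrow> 'a list \<Rightarrow> real" where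
  "path_sum w (x # y # zs) = w x y + path_sum w (y # zs)"
| "path_sum w zs = 0"

text \<open>
  Splitting at a junction isolates the one term that depends on which pieces are neighbours; the
  remaining terms cancel when two orders of the same pieces are compared.
\<close>

lemma path_sum_append:
  "xs \<noteq> [] \<Longrightarrow> ys \<noteq> [] \<Longrightarrow>
    path_sum w (xs @ ys) = path_sum w xs + w (last xs) (hd ys) + path_sum w ys"
proof (induction xs rule: induct_list012)
  case (2 x) then show ?case by (cases ys) auto
qed auto

lemma sum_along_path:
  "L \<noteq> [] \<Longrightarrow> distinct L \<Longrightarrow> successively (\<lambda>x y. \<sigma> x = y) L \<Longrightarrow>
    (\<Sum>x\<in>set L. w x (\<sigma> x)) = path_sum w L + w (last L) (\<sigma> (last L))"
  by (induction w L rule: path_sum.induct) auto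

lemma successively_determines_images:
  "successively (\<lambda>x y. f x = y) p \<Longrightarrow> successively (\<lambda>x y. g x = y) p \<Longrightarrow>
    x \<in> set (butlast p) \<Longrightarrow> f x = g x"
  by (induction p rule: induct_list012) (auto split: if_splits)

section \<open>Covering the index set by the paths of an acyclic partial injection\<close>

text \<open>
  Only the restriction of \<open>\<tau>\<close> to \<open>J\<close> matters: \<open>\<tau>\<close> stands for a map defined on \<open>J\<close>, and a
  \<open>J\<close>-circuit \<open>x\<close> with \<open>x\<^sub>j = v\<^bsub>\<tau> j\<^esub>\<close> creates no cycle exactly if \<open>\<tau>\<close> is acyclic on \<open>J\<close>.
\<close>

definition acyclic_on :: "('a \<Rightarrow> 'a) \<Rightarrow> 'a set \<Rightarrow> bool" where
  "acyclic_on \<tau> J \<longleftrightarrow>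
    \<not> (\<exists>p. p \<noteq> [] \<and> distinct p \<and> set p \<subseteq> J \<and> successively (\<lambda>x y. \<tau> x = y) p \<and> \<tau> (last p) = hd p)"

lemma acyclic_onD:
  "acyclic_on \<tau> J \<Longrightarrow> p \<noteq> [] \<Longrightarrow> distinct p \<Longrightarrow> set p \<subseteq> J \<Longrightarrow> successively (\<lambda>x y. \<tau> x = y) p \<Longrightarrow>
    \<tau> (last p) \<noteq> hd p"
  unfolding acyclic_on_def by blast

lemma acyclic_on_subset: "acyclic_on \<tau> J \<Longrightarrow> I \<subseteq> J \<Longrightarrow> acyclic_on \<tau> I"
  unfolding acyclic_on_def by (meson order_trans)

text \<open>
  These are the maximal paths of the digraph with an arc from \<open>j\<close> to \<open>\<tau> j\<close> for \<open>j \<in> J\<close>; maximality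
  is expressed by requiring that a path stops precisely where it leaves \<open>J\<close>.
\<close>

definition path_cover :: "('a \<Rightarrow> 'a) \<Rightarrow> 'a set \<Rightarrow> 'a list set \<Rightarrow> bool" where
  "path_cover \<tau> J P \<longleftrightarrow>
    (\<forall>p\<in>P. p \<noteq> [] \<and> distinct p \<and> successively (\<lambda>x y. \<tau> x = y) p \<and>
            set (butlast p) \<subseteq> J \<and> last p \<notin> J) \<and>
    (\<forall>p\<in>P. \<forall>q\<in>P. p \<noteq> q \<longrightarrow> set p \<inter> set q = {}) \<and>
    (\<Union>p\<in>P. set p) = UNIV"

lemma path_cover_covers: "path_cover \<tau> J P \<Longrightarrow> \<exists>p\<in>P. x \<in> set p"
  unfolding path_cover_def by (metis UNIV_I UN_E)

lemma path_cover_disjoint: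
  "path_cover \<tau> J P \<Longrightarrow> p \<in> P \<Longrightarrow> q \<in> P \<Longrightarrow> x \<in> set p \<Longrightarrow> x \<in> set q \<Longrightarrow> p = q"
  unfolding path_cover_def by (metis disjoint_iff)

lemma path_cover_path:
  assumes "path_cover \<tau> J P" "p \<in> P"
  shows "p \<noteq> []" "distinct p" "successively (\<lambda>x y. \<tau> x = y) p" "set (butlast p) \<subseteq> J" "last p \<notin> J"
  using assms unfolding path_cover_def by auto

lemma in_set_butlast_or_last: "x \<in> set p \<Longrightarrow> x \<in> set (butlast p) \<or> x = last p"
  by (induction p) auto

lemma in_tail_imp_successor:
  "successively (\<lambda>x y. \<tau> x = y) p \<Longrightarrow> y \<in> set p \<Longrightarrow> y \<noteq> hd p \<Longrightarrow> \<exists>x\<in>set (butlast p). \<tau> x = y"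
  by (induction p rule: induct_list012) auto

text \<open>
  Adding one arc from \<open>j\<close> to \<open>\<tau> j\<close> joins two paths: \<open>j\<close> was the end of its path because it lay
  outside the old domain, \<open>\<tau> j\<close> was the start of its path by injectivity, and the two paths differ
  since otherwise the arc would close a cycle.
\<close>

lemma path_cover_exists:
  assumes "finite J" "inj_on \<tau> J" "acyclic_on \<tau> J"
  shows "\<exists>P. path_cover \<tau> J P"
  using assms
proof (induction J rule: finite_induct)
  case empty
  have "path_cover \<tau> {} ((\<lambda>x. [x]) ` UNIV)" unfolding path_cover_def by auto
  then show ?case by blast
next
  case (insert j J)
  have "inj_on \<tau> J" "acyclic_on \<tau> J"
    using insert.prems acyclic_on_subset[of \<tau> "insert j J" J] by auto
  then obtain P where P: "path_cover \<tau> J P" using insert.IH by blast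
  then obtain p q where p: "p \<in> P" "j \<in> set p" and q: "q \<in> P" "\<tau> j \<in> set q"
    using path_cover_covers by metis
  note p' = path_cover_path[OF P p(1)] and q' = path_cover_path[OF P q(1)]
  have last_p: "last p = j"
    using in_set_butlast_or_last[OF p(2)] p'(4) insert.hyps by auto
  have set_p: "set p \<subseteq> insert j J"
  proof
    fix x assume "x \<in> set p"
    then show "x \<in> insert j J" using in_set_butlast_or_last[of x p] p'(4) last_p by auto
  qed
  have hd_q: "hd q = \<tau> j"
  proof (rule ccontr)
    assume "hd q \<noteq> \<tau> j"
    then obtain x where "x \<in> set (butlast q)" "\<tau> x = \<tau> j"
      using in_tail_imp_successor[OF q'(3) q(2)] by auto
    then show False
      using q'(4) insert.prems(1) insert.hyps(2) by (metis inj_on_def insertCI subsetD)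
  qed
  have "p \<noteq> q"
  proof
    assume "p = q"
    then show False
      using acyclic_onD[OF insert.prems(2) p'(1,2) set_p p'(3)] last_p hd_q by simp
  qed
  then have disj: "set p \<inter> set q = {}" using path_cover_disjoint[OF P p(1) q(1)] by blast
  have "path_cover \<tau> (insert j J) (insert (p @ q) (P - {p, q}))"
    unfolding path_cover_def
  proof (intro conjI)
    show "\<forall>r\<in>insert (p @ q) (P - {p, q}). r \<noteq> [] \<and> distinct r \<and>
        successively (\<lambda>x y. \<tau> x = y) r \<and> set (butlast r) \<subseteq> insert j J \<and> last r \<notin> insert j J"
    proof
      fix r assume "r \<in> insert (p @ q) (P - {p, q})"
      then consider "r = p @ q" | "r \<in> P" "r \<noteq> p" by auto
      then show "r \<noteq> [] \<and> distinct r \<and> successively (\<lambda>x y. \<tau> x = y) r \<and>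
          set (butlast r) \<subseteq> insert j J \<and> last r \<notin> insert j J"
      proof cases
        case 1
        have "last q \<noteq> j" using disj p(2) last_in_set[OF q'(1)] by blast
        moreover have "set (butlast (p @ q)) \<subseteq> insert j J"
          using set_p q'(1,4) by (auto simp: butlast_append)
        moreover have "successively (\<lambda>x y. \<tau> x = y) (p @ q)"
          using p'(3) q'(3) last_p hd_q by (simp add: successively_append_iff)
        ultimately show ?thesis using 1 p'(1,2) q'(1,2,5) disj by simp
      next
        case 2
        note r' = path_cover_path[OF P 2(1)]
        have "j \<notin> set r" using path_cover_disjoint[OF P p(1) 2(1) p(2)] 2(2) by blast
        then have "last r \<noteq> j" using last_in_set[OF r'(1)] by blast
        then show ?thesis using r' by auto
      qed
    qed
    show "\<forall>r\<in>insert (p @ q) (P - {p, q}). \<forall>s\<in>insert (p @ q) (P - {p, q}).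
        r \<noteq> s \<longrightarrow> set r \<inter> set s = {}"
    proof (intro ballI impI equals0I)
      fix r s x assume rs: "r \<in> insert (p @ q) (P - {p, q})" "s \<in> insert (p @ q) (P - {p, q})"
        and neq: "r \<noteq> s" and x: "x \<in> set r \<inter> set s"
      have merged: "t = p @ q" if "t \<in> insert (p @ q) (P - {p, q})" "x \<in> set t" "x \<in> set p \<union> set q" for t
        using that path_cover_disjoint[OF P p(1), of t x] path_cover_disjoint[OF P q(1), of t x]
        by blast
      show False
      proof (cases "x \<in> set p \<union> set q")
        case True
        then show False using merged[OF rs(1)] merged[OF rs(2)] x neq by simp
      next
        case False
        then have "r \<in> P" "s \<in> P" using rs x by auto
        then show False using path_cover_disjoint[OF P, of r s x] x neq by simp
      qed
    qed
    show "(\<Union>r\<in>insert (p @ q) (P - {p, q}). set r) = UNIV"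
    proof -
      have "(\<Union>r\<in>insert (p @ q) (P - {p, q}). set r) = (\<Union>r\<in>P. set r)"
        using p(1) q(1) by auto
      then show ?thesis using P unfolding path_cover_def by simp
    qed
  qed
  then show ?case by blast
qed

lemma path_cover_finite:
  assumes "path_cover \<tau> J (P :: 'a::finite list set)"
  shows "finite P"
proof -
  have "inj_on set P"
    using assms unfolding path_cover_def inj_on_def by (metis Int_absorb set_empty)
  then show ?thesis by (rule finite_imageD[rotated]) simp
qed

lemma path_ending_at:
  assumes "path_cover \<tau> J P" "i \<notin> J"
  obtains p where "p \<in> P" "last p = i"
proof -
  obtain p where "p \<in> P" "i \<in> set p" using path_cover_covers[OF assms(1)] by blast
  then show thesis
    using that in_set_butlast_or_last[of i p] path_cover_path(4)[OF assms(1), of p] assms(2) by auto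
qed

text \<open>
  Closing up any concatenation of the paths gives a Hamiltonian cycle that extends \<open>\<tau>\<close>, because each
  index of \<open>J\<close> lies inside a path and keeps its successor. The weight \<open>w\<close> is quantified after the
  permutation so that it can be chosen to be the functional under study.
\<close>

lemma arrangement_gives_circuit:
  fixes P :: "'a::finite list set"
  assumes cover: "path_cover \<tau> J P" and ps: "set ps = P" "distinct ps"
  shows "\<exists>\<sigma>. \<sigma> permutes UNIV \<and> cyclic_on \<sigma> UNIV \<and> (\<forall>j\<in>J. \<sigma> j = \<tau> j) \<and>
    (\<forall>w. (\<Sum>x\<in>UNIV. w x (\<sigma> x)) = path_sum w (concat ps) + w (last (concat ps)) (hd (concat ps)))"
proof -
  let ?L = "concat ps"
  have setL: "set ?L = UNIV" using cover ps unfolding path_cover_def by simp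
  then have ne: "?L \<noteq> []" by force
  have "removeAll [] ps = ps" using cover ps unfolding path_cover_def by (auto intro: removeAll_id)
  then have dist: "distinct ?L"
    using cover ps unfolding path_cover_def by (subst distinct_concat_iff) simp
  obtain \<sigma> where \<sigma>: "\<sigma> permutes UNIV" "cyclic_on \<sigma> UNIV"
    "successively (\<lambda>x y. \<sigma> x = y) ?L" "\<sigma> (last ?L) = hd ?L"
    using cyclic_permutation_of_list[OF dist ne] setL by metis
  have "\<sigma> j = \<tau> j" if "j \<in> J" for j
  proof -
    obtain p where p: "p \<in> P" "j \<in> set p" using cover unfolding path_cover_def by blast
    then have "successively (\<lambda>x y. \<tau> x = y) p" "last p \<notin> J"
      using cover unfolding path_cover_def by auto
    moreover have "j \<in> set (butlast p)"
      using in_set_butlast_or_last[OF p(2)] \<open>last p \<notin> J\<close> that by auto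
    moreover obtain us ws where "ps = us @ p # ws" using p(1) ps(1) split_list by metis
    then have "successively (\<lambda>x y. \<sigma> x = y) p"
      using \<sigma>(3) by (simp add: successively_append_iff)
    ultimately show ?thesis by (metis successively_determines_images)
  qed
  moreover have "(\<Sum>x\<in>UNIV. w x (\<sigma> x)) = path_sum w ?L + w (last ?L) (hd ?L)" for w
    using sum_along_path[OF ne dist \<sigma>(3), of w] setL \<sigma>(4) by simp
  ultimately show ?thesis using \<sigma>(1,2) by blast
qed

lemma circuit_extension_exists:
  fixes J :: "'a::finite set"
  assumes "inj_on \<tau> J" "acyclic_on \<tau> J"
  obtains \<sigma> where "\<sigma> permutes UNIV" "cyclic_on \<sigma> UNIV" "\<forall>j\<in>J. \<sigma> j = \<tau> j"
proof -
  obtain P where P: "path_cover \<tau> J P" using path_cover_exists assms finite by metis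
  obtain ps where "set ps = P" "distinct ps"
    using finite_distinct_list[OF path_cover_finite[OF P]] by blast
  then show thesis using arrangement_gives_circuit[OF P] that by metis
qed

section \<open>Functionals constant on all circuits extending a partial one\<close>

text \<open>
  The entries \<open>c\<close> belong to the exits and \<open>w\<close> to the entrances of four blocks. Each equation compares
  two cyclic orders of the blocks that differ by exchanging two adjacent ones, and the three
  equations arise from each other by rotating the first three blocks. With \<open>p = (cc - cb) (wa - wd)\<close>,
  \<open>q = (ca - cc) (wb - wd)\<close> and \<open>r = (cb - ca) (wc - wd)\<close> they say \<open>q + r = 0\<close>, \<open>r + p = 0\<close> and
  \<open>p + q = 0\<close>, so all three products vanish.
\<close>

lemma cycles_through_four_nodes_force_equality:
  fixes ca cb cc wa wb wc wd :: real
  assumes "wc \<noteq> wd"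
    and "ca * wb + cb * wc + cc * wd = ca * wc + cc * wb + cb * wd"
    and "cb * wc + cc * wa + ca * wd = cb * wa + ca * wc + cc * wd"
    and "cc * wa + ca * wb + cb * wd = cc * wb + cb * wa + ca * wd"
  shows "ca = cb"
proof -
  have "(wc - wd) * (ca - cb) = 0" using assms(2-4) by (simp add: algebra_simps)
  then show ?thesis using assms(1) by simp
qed

text \<open>
  Four blocks are the least number that works: with three there are only two cyclic orders, hence
  a single equation. This is where the bound \<open>card J + 4 \<le> n\<close> enters.
\<close>

lemma functional_constant_on_extensions:
  fixes J :: "'a::finite set" and u c :: "'a \<Rightarrow> real"
  assumes inj: "inj_on \<tau> J" and acyc: "acyclic_on \<tau> J"
    and card: "card J + 4 \<le> CARD('a)" and u: "inj u"
    and const: "\<And>\<sigma>. \<sigma> permutes UNIV \<Longrightarrow> cyclic_on \<sigma> UNIV \<Longrightarrow> \<forall>j\<in>J. \<sigma> j = \<tau> j \<Longrightarrow>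
      (\<Sum>x\<in>UNIV. c x * u (\<sigma> x)) = \<gamma>"
    and ik: "i \<notin> J" "k \<notin> J"
  shows "c i = c k"
proof (cases "i = k")
  case False
  obtain P where P: "path_cover \<tau> J P" using path_cover_exists[OF _ inj acyc] by auto
  have "card (- J) \<ge> 4" using card by (simp add: Compl_eq_Diff_UNIV card_Diff_subset)
  then have "card (- J - {i, k}) \<ge> 2"
    using ik False by (simp add: card_Diff_subset)
  then obtain U where "U \<subseteq> - J - {i, k}" "card U = 2"
    using obtain_subset_with_card_n by metis
  then obtain l d where "{l, d} \<subseteq> - J - {i, k}" "l \<noteq> d"
    unfolding card_2_iff by blast
  then have ld: "l \<notin> J" "d \<notin> J" "l \<noteq> d" "l \<noteq> i" "l \<noteq> k" "d \<noteq> i" "d \<noteq> k" by auto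
  obtain A where A: "A \<in> P" "last A = i" using path_ending_at[OF P ik(1)] by metis
  obtain B where B: "B \<in> P" "last B = k" using path_ending_at[OF P ik(2)] by metis
  obtain C where C: "C \<in> P" "last C = l" using path_ending_at[OF P ld(1)] by metis
  obtain D where D: "D \<in> P" "last D = d" using path_ending_at[OF P ld(2)] by metis
  note mem = A(1) B(1) C(1) D(1) and last = A(2) B(2) C(2) D(2)
  have ne: "A \<noteq> []" "B \<noteq> []" "C \<noteq> []" "D \<noteq> []" using path_cover_path(1)[OF P] mem by auto
  have neq: "distinct [A, B, C, D]" using last False ld by auto
  obtain rest where rest: "set rest = P - {A, B, C, D}" "distinct rest"
    using finite_distinct_list[of "P - {A, B, C, D}"] path_cover_finite[OF P] by auto
  \<comment> \<open>All remaining paths are glued to the fourth one, leaving exactly four blocks to permute.\<close>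
  define D' where "D' = D @ concat rest"
  define w where "w x y = c x * u y" for x y
  have D': "D' \<noteq> []" "hd D' = hd D" using ne unfolding D'_def by auto
  have total: "path_sum w (X @ Y @ Z @ D') + w (last D') (hd X) = \<gamma>"
    if "{X, Y, Z} = {A, B, C}" "distinct [X, Y, Z]" for X Y Z
  proof -
    let ?ps = "[X, Y, Z] @ (D # rest)"
    have "set ?ps = {X, Y, Z} \<union> insert D (set rest)" by auto
    also have "\<dots> = {A, B, C} \<union> insert D (P - {A, B, C, D})" by (simp only: that(1) rest(1))
    also have "\<dots> = P" using mem by blast
    finally have set_ps: "set ?ps = P" .
    have "{A, B, C} \<inter> insert D (P - {A, B, C, D}) = {}" using neq by auto
    then have "{X, Y, Z} \<inter> insert D (set rest) = {}" by (simp only: that(1) rest(1))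
    moreover have "distinct (D # rest)" using rest by simp
    ultimately have dist_ps: "distinct ?ps" using that(2) by (simp only: distinct_append) simp
    obtain \<sigma> where \<sigma>: "\<sigma> permutes UNIV" "cyclic_on \<sigma> UNIV" "\<forall>j\<in>J. \<sigma> j = \<tau> j"
      and sum: "\<forall>w. (\<Sum>x\<in>UNIV. w x (\<sigma> x)) =
        path_sum w (concat ?ps) + w (last (concat ?ps)) (hd (concat ?ps))"
      using arrangement_gives_circuit[OF P set_ps dist_ps] by blast
    then have "(\<Sum>x\<in>UNIV. w x (\<sigma> x)) = \<gamma>" using const[OF \<sigma>] by (simp only: w_def)
    moreover have "X \<in> {A, B, C}" unfolding that(1)[symmetric] by simp
    then have "X \<noteq> []" using ne by auto
    then have "hd (concat ?ps) = hd X" "concat ?ps = X @ Y @ Z @ D'" "last (concat ?ps) = last D'"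
      using D' unfolding D'_def by auto
    ultimately show ?thesis using sum by simp
  qed
  have joins: "path_sum w X + path_sum w Y + path_sum w Z + path_sum w D' +
      w (last X) (hd Y) + w (last Y) (hd Z) + w (last Z) (hd D) + w (last D') (hd X) = \<gamma>"
    if "{X, Y, Z} = {A, B, C}" "distinct [X, Y, Z]" for X Y Z
  proof -
    have "X \<in> {A, B, C}" "Y \<in> {A, B, C}" "Z \<in> {A, B, C}"
      unfolding that(1)[symmetric] by simp_all
    then have "X \<noteq> []" "Y \<noteq> []" "Z \<noteq> []" using ne by auto
    then show ?thesis using total[OF that] D' by (simp add: path_sum_append)
  qed
  have abc: "A \<noteq> B" "A \<noteq> C" "B \<noteq> C" "B \<noteq> A" "C \<noteq> A" "C \<noteq> B" using neq by auto
  \<comment> \<open>The term leaving the fourth block depends only on the first one, so orders are compared in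
    pairs with the same first block.\<close>
  note eqs = joins[of A B C] joins[of A C B] joins[of B C A] joins[of B A C]
    joins[of C A B] joins[of C B A]
  have "hd C \<noteq> hd D"
    using path_cover_disjoint[OF P mem(3,4)] neq ne(3,4) hd_in_set by fastforce
  show ?thesis
  proof (rule cycles_through_four_nodes_force_equality)
    show "u (hd C) \<noteq> u (hd D)" using \<open>hd C \<noteq> hd D\<close> u by (simp add: inj_eq)
    show "c i * u (hd B) + c k * u (hd C) + c l * u (hd D)
        = c i * u (hd C) + c l * u (hd B) + c k * u (hd D)"
      using eqs(1,2) abc last by (simp add: w_def insert_commute)
    show "c k * u (hd C) + c l * u (hd A) + c i * u (hd D)
        = c k * u (hd A) + c i * u (hd C) + c l * u (hd D)"
      using eqs(3,4) abc last by (simp add: w_def insert_commute)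
    show "c l * u (hd A) + c i * u (hd B) + c k * u (hd D)
        = c l * u (hd B) + c k * u (hd A) + c i * u (hd D)"
      using eqs(5,6) abc last by (simp add: w_def insert_commute)
  qed
qed simp

section \<open>Recognising a facet by the equations that hold on it\<close>

text \<open>
  The face together with one further point \<open>p\<close> of the polytope spans the polytope affinely:
  otherwise some hyperplane contains the face and \<open>p\<close> but not the polytope, whereas an equation
  proportional to the given one that holds at \<open>p\<close> is trivial. So the face loses just one dimension.
\<close>

lemma facet_by_functionals:
  fixes P :: "'b::euclidean_space set"
  assumes "convex P" and ge: "\<And>x. x \<in> P \<Longrightarrow> a \<bullet> x \<ge> \<alpha>"
    and nonempty: "{x\<in>P. a \<bullet> x = \<alpha>} \<noteq> {}" and p: "p \<in> P" "a \<bullet> p \<noteq> \<alpha>"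
    and functionals: "\<And>c \<gamma>. (\<And>x. x \<in> P \<Longrightarrow> a \<bullet> x = \<alpha> \<Longrightarrow> c \<bullet> x = \<gamma>) \<Longrightarrow>
      \<exists>l. \<forall>x\<in>P. c \<bullet> x - \<gamma> = l * (a \<bullet> x - \<alpha>)"
  shows "{x\<in>P. a \<bullet> x = \<alpha>} facet_of P"
proof -
  let ?F = "{x\<in>P. a \<bullet> x = \<alpha>}"
  have F_eq: "?F = P \<inter> {x. a \<bullet> x = \<alpha>}" by auto
  have face: "?F face_of P"
    unfolding F_eq by (rule face_of_Int_supporting_hyperplane_ge[OF assms(1) ge])
  have "?F \<noteq> P" using p by auto
  then have lt: "aff_dim ?F < aff_dim P" using face_of_aff_dim_lt[OF assms(1) face] by blast
  have "P \<subseteq> affine hull (insert p ?F)"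
  proof (rule ccontr)
    assume "\<not> P \<subseteq> affine hull (insert p ?F)"
    then obtain q where q: "q \<in> P" "q \<notin> affine hull (insert p ?F)" by blast
    obtain H where H: "affine hull (insert p ?F) = \<Inter>H"
      and hyp: "\<And>h. h \<in> H \<Longrightarrow> \<exists>c \<gamma>. c \<noteq> 0 \<and> h = {x. c \<bullet> x = \<gamma>}"
      using affine_hull_finite_intersection_hyperplanes[of "insert p ?F"] by metis
    obtain h where h: "h \<in> H" "q \<notin> h" using q(2) H by auto
    obtain c \<gamma> where c: "h = {x. c \<bullet> x = \<gamma>}" using hyp[OF h(1)] by blast
    have on_hull: "c \<bullet> x = \<gamma>" if "x \<in> insert p ?F" for x
    proof -
      have "x \<in> \<Inter>H" using hull_inc[OF that, of affine] H by simp
      then show ?thesis using h(1) c by auto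
    qed
    obtain l where l: "\<forall>x\<in>P. c \<bullet> x - \<gamma> = l * (a \<bullet> x - \<alpha>)"
      using functionals[of c \<gamma>] on_hull by blast
    have "l = 0" using l p on_hull[of p] by auto
    then have "c \<bullet> q = \<gamma>" using l q(1) by auto
    then show False using h(2) c by simp
  qed
  then have "aff_dim P \<le> aff_dim (insert p ?F)"
    by (metis aff_dim_affine_hull aff_dim_subset)
  also have "\<dots> \<le> aff_dim ?F + 1" by (simp add: aff_dim_insert)
  finally have "aff_dim ?F = aff_dim P - 1" using lt by linarith
  then show ?thesis using face nonempty unfolding facet_of_def by blast
qed

text \<open>
  The differences of the points of \<open>T\<close> span a hyperplane of \<open>V\<close> to which both \<open>a\<close> and \<open>c\<close> are
  orthogonal, and its orthogonal complement within \<open>V\<close> is a line.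
\<close>

lemma functional_proportional:
  fixes a c :: "'b::euclidean_space"
  assumes V: "subspace V" "dim V \<le> card T" and sub: "T \<subseteq> V" "a \<in> V" "c \<in> V" and "a \<noteq> 0"
    and indep: "\<not> affine_dependent T" and t0: "t0 \<in> T"
    and a: "\<And>t. t \<in> T \<Longrightarrow> a \<bullet> t = \<alpha>" and c: "\<And>t. t \<in> T \<Longrightarrow> c \<bullet> t = \<gamma>"
  shows "\<exists>l. c = l *\<^sub>R a"
proof -
  let ?D = "(\<lambda>t. - t0 + t) ` (T - {t0})"
  have indep_D: "independent ?D"
    using affine_dependent_iff_dependent2[OF t0] indep by blast
  have D_sub: "?D \<subseteq> V"
    using sub(1) t0 subspace_add[OF V(1) subspace_neg[OF V(1)]] by blast
  have orth: "c \<bullet> d = 0" "a \<bullet> d = 0" if "d \<in> ?D" for d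
    using that a c t0 by (auto simp: inner_diff_right)
  have orth_span: "x \<bullet> d = 0" if "d \<in> span ?D" "\<And>e. e \<in> ?D \<Longrightarrow> x \<bullet> e = 0" for x d
    using orthogonal_to_span[OF that(1), of x] that(2) unfolding orthogonal_def by blast
  have "a \<notin> span ?D"
    using orth_span[of a a] orth(2) \<open>a \<noteq> 0\<close> by (metis inner_eq_zero_iff)
  then have indep': "independent (insert a ?D)" by (rule independent_insertI[OF _ indep_D])
  have "a \<notin> ?D" using \<open>a \<notin> span ?D\<close> by (rule contra_subsetD[OF span_superset])
  have fin: "finite T" using aff_independent_finite indep by blast
  have "card ?D = card T - 1"
    using t0 by (simp add: card_image)
  moreover have "card T > 0" using fin t0 by (auto simp: card_gt_0_iff)
  moreover have "card (insert a ?D) = Suc (card ?D)"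
    using \<open>a \<notin> ?D\<close> fin by (intro card_insert_disjoint) auto
  ultimately have "card (insert a ?D) = card T" by simp
  then have "V \<subseteq> span (insert a ?D)"
    using card_ge_dim_independent[of "insert a ?D" V] D_sub sub(2) V(2) indep' by simp
  then obtain l where l: "c - l *\<^sub>R a \<in> span ?D"
    using sub(3) span_breakdown_eq[of c a ?D] by blast
  have "(c - l *\<^sub>R a) \<bullet> (c - l *\<^sub>R a) = 0"
  proof (rule orth_span[OF l])
    fix e assume "e \<in> ?D"
    then show "(c - l *\<^sub>R a) \<bullet> e = 0"
      using orth[of e] by (simp add: inner_diff_left)
  qed
  then have "c = l *\<^sub>R a" by simp
  then show ?thesis ..
qed

section \<open>Circuits and partial circuits\<close>

definition tuple_vec :: "real ^ 'n \<Rightarrow> 'n set \<Rightarrow> ('n \<Rightarrow> 'n) \<Rightarrow> real ^ 'n" where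
  "tuple_vec v J \<tau> = (\<chi> j. if j \<in> J then v $ \<tau> j else 0)"

lemma J_circuit_tuple_vec:
  fixes v :: "real ^ 'n"
  assumes v: "inj (\<lambda>i. v $ i)"
  shows "J_circuit v J (tuple_vec v J \<tau>) \<longleftrightarrow> inj_on \<tau> J \<and> acyclic_on \<tau> J"
proof -
  have v_eq: "v $ i = v $ k \<longleftrightarrow> i = k" for i k using v by (auto dest: injD)
  have "inj_on (\<lambda>j. tuple_vec v J \<tau> $ j) J \<longleftrightarrow> inj_on \<tau> J"
    by (simp add: tuple_vec_def inj_on_def v_eq)
  moreover have "(\<forall>t. Suc t < length p \<longrightarrow> tuple_vec v J \<tau> $ (p ! t) = v $ (p ! Suc t)) \<longleftrightarrow>
      successively (\<lambda>x y. \<tau> x = y) p" if "set p \<subseteq> J" for p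
  proof -
    have "p ! t \<in> J" if "Suc t < length p" for t
      using \<open>set p \<subseteq> J\<close> that by (meson Suc_lessD nth_mem subsetD)
    then show ?thesis by (auto simp: successively_conv_nth tuple_vec_def v_eq)
  qed
  moreover have "tuple_vec v J \<tau> $ last p = v $ hd p \<longleftrightarrow> \<tau> (last p) = hd p"
    if "p \<noteq> []" "set p \<subseteq> J" for p
  proof -
    have "last p \<in> J" using that last_in_set[OF that(1)] by blast
    then show ?thesis by (simp add: tuple_vec_def v_eq)
  qed
  ultimately have inj_eq: "inj_on (\<lambda>j. tuple_vec v J \<tau> $ j) J \<longleftrightarrow> inj_on \<tau> J"
    and cycle_eq: "p \<noteq> [] \<and> distinct p \<and> set p \<subseteq> J \<and>
        (\<forall>t. Suc t < length p \<longrightarrow> tuple_vec v J \<tau> $ (p ! t) = v $ (p ! Suc t)) \<and>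
        tuple_vec v J \<tau> $ last p = v $ hd p \<longleftrightarrow>
      p \<noteq> [] \<and> distinct p \<and> set p \<subseteq> J \<and> successively (\<lambda>x y. \<tau> x = y) p \<and> \<tau> (last p) = hd p" for p
    by blast+
  have "J_circuit v J (tuple_vec v J \<tau>) \<longleftrightarrow> (\<forall>j. j \<notin> J \<longrightarrow> tuple_vec v J \<tau> $ j = 0) \<and>
     (\<forall>j\<in>J. \<exists>i. tuple_vec v J \<tau> $ j = v $ i) \<and> inj_on \<tau> J \<and> acyclic_on \<tau> J"
    unfolding J_circuit_def acyclic_on_def inj_eq cycle_eq ..
  then show ?thesis by (auto simp: tuple_vec_def)
qed

lemma J_circuit_imp_tuple_vec:
  assumes "J_circuit v J x"
  obtains \<tau> where "x = tuple_vec v J \<tau>"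
proof -
  have "\<forall>j\<in>J. \<exists>i. x $ j = v $ i" using assms unfolding J_circuit_def by blast
  then obtain \<tau> where "\<forall>j\<in>J. x $ j = v $ \<tau> j" by (rule bchoice[THEN exE])
  moreover have "\<forall>j. j \<notin> J \<longrightarrow> x $ j = 0" using assms unfolding J_circuit_def by blast
  ultimately have "x = tuple_vec v J \<tau>" by (simp add: tuple_vec_def vec_eq_iff)
  then show thesis by (rule that)
qed

lemma finite_J_circuits: "finite {x :: real ^ 'n. J_circuit v J x}"
proof (rule finite_subset)
  show "{x. J_circuit v J x} \<subseteq> range (tuple_vec v J)"
    using J_circuit_imp_tuple_vec by fastforce
qed simp

text \<open>The entries of a cycle inside \<open>J\<close> would be closed under \<open>\<sigma>\<close>, hence contain a whole orbit.\<close>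

lemma cyclic_imp_acyclic_on:
  assumes "cyclic_on \<sigma> UNIV" "J \<noteq> UNIV"
  shows "acyclic_on \<sigma> J"
  unfolding acyclic_on_def
proof (rule notI, elim exE conjE)
  fix p assume p: "p \<noteq> []" "set p \<subseteq> J" "successively (\<lambda>x y. \<sigma> x = y) p" "\<sigma> (last p) = hd p"
  have closed: "\<sigma> x \<in> set p" if "x \<in> set p" for x
  proof (cases "x = last p")
    case True then show ?thesis using p by simp
  next
    case False
    obtain us ws where us: "p = us @ x # ws" using \<open>x \<in> set p\<close> split_list by metis
    then have "ws \<noteq> []" using False by auto
    then have "\<sigma> x = hd ws" using p(3) us by (simp add: successively_append_iff successively_Cons)
    then show ?thesis using us \<open>ws \<noteq> []\<close> by simp
  qed
  have "y \<in> set p" if "y \<in> orbit \<sigma> (hd p)" for y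
    using that by induction (use closed p(1) in auto)
  moreover have "orbit \<sigma> (hd p) = UNIV" using assms(1) unfolding cyclic_on_alldef by blast
  ultimately show False using p(2) assms(2) by blast
qed

text \<open>
  A \<open>J\<close>-circuit of least value is undominated, since a different one dominating it would have a
  strictly smaller value; so the bound holds at the minimum.
\<close>

lemma undominated_bound_imp_J_circuit_bound:
  fixes a :: "'n::finite \<Rightarrow> real"
  assumes nonzero: "\<And>j. j \<in> J \<Longrightarrow> a j \<noteq> 0"
    and bound: "\<And>x. undominated v J {j \<in> J. a j > 0} {j \<in> J. a j < 0} x \<Longrightarrow> (\<Sum>j\<in>J. a j * x $ j) \<ge> \<alpha>"
    and x: "J_circuit v J x"
  shows "(\<Sum>j\<in>J. a j * x $ j) \<ge> \<alpha>"
proof -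
  define f where "f x = (\<Sum>j\<in>J. a j * x $ j)" for x :: "real ^ 'n"
  define y where "y = arg_min_on f {x. J_circuit v J x}"
  have y: "J_circuit v J y"
    using arg_min_if_finite(1)[OF finite_J_circuits, of v J f] x unfolding y_def by blast
  have y_min: "f y \<le> f z" if "J_circuit v J z" for z
    using arg_min_least[OF finite_J_circuits, of v J z f] that unfolding y_def by blast
  have "undominated v J {j \<in> J. a j > 0} {j \<in> J. a j < 0} y"
    unfolding undominated_def
  proof (intro conjI y notI, elim exE conjE)
    fix z assume z: "J_circuit v J z" "z \<noteq> y"
      and dom: "dominates {j \<in> J. a j > 0} {j \<in> J. a j < 0} z y"
    have le: "a j * z $ j \<le> a j * y $ j" if "j \<in> J" for j
    proof (cases "a j > 0")
      case True
      then have "z $ j \<le> y $ j" using dom that unfolding dominates_def by blast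
      then show ?thesis using True by simp
    next
      case False
      then have "a j < 0" using nonzero[OF that] by simp
      moreover from this have "z $ j \<ge> y $ j" using dom that unfolding dominates_def by blast
      ultimately show ?thesis by simp
    qed
    have "\<exists>j\<in>J. z $ j \<noteq> y $ j"
      using z y unfolding J_circuit_def vec_eq_iff by metis
    then obtain j where j: "j \<in> J" "z $ j \<noteq> y $ j" by blast
    then have "a j * z $ j < a j * y $ j"
      using le[OF j(1)] nonzero[OF j(1)] by (simp add: order_less_le)
    then have "f z < f y"
      unfolding f_def using le j(1) by (intro sum_strict_mono_ex1) auto
    then show False using y_min[OF z(1)] by simp
  qed
  then have "f y \<ge> \<alpha>" using bound unfolding f_def by blast
  then show ?thesis using y_min[OF x] unfolding f_def by simp
qed

text \<open>
  Every circuit permutes the entries of \<open>v\<close>, so the polytope lies in a hyperplane and functionals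
  matter only up to multiples of the all-ones vector.
\<close>

lemma sum_circuit_polytope:
  assumes "x \<in> circuit_polytope v"
  shows "(\<Sum>i\<in>UNIV. x $ i) = (\<Sum>i\<in>UNIV. v $ i)"
proof -
  have one: "(\<chi> i. 1) \<bullet> y = (\<Sum>i\<in>UNIV. y $ i)" for y :: "real ^ 'a" by (simp add: inner_vec_def)
  have "circuit_polytope v \<subseteq> {y. (\<chi> i. 1) \<bullet> y = (\<Sum>i\<in>UNIV. v $ i)}"
    unfolding circuit_polytope_def
  proof (rule hull_minimal)
    show "{x. circuit v x} \<subseteq> {y. (\<chi> i. 1) \<bullet> y = (\<Sum>i\<in>UNIV. v $ i)}"
    proof
      fix y assume "y \<in> {x. circuit v x}"
      then obtain \<sigma> where "\<sigma> permutes UNIV" "\<forall>i. y $ i = v $ \<sigma> i"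
        unfolding circuit_def by blast
      then have "(\<Sum>i\<in>UNIV. y $ i) = (\<Sum>i\<in>UNIV. v $ i)"
        using sum.permute[of \<sigma> UNIV "\<lambda>i. v $ i"] by (simp add: comp_def)
      then show "y \<in> {y. (\<chi> i. 1) \<bullet> y = (\<Sum>i\<in>UNIV. v $ i)}" by (simp add: one)
    qed
  qed (rule convex_hyperplane)
  then show ?thesis using assms one by auto
qed

section \<open>The facet theorem\<close>

theorem theorem5:
  fixes v :: "real ^ 'n::{finite,linorder}" and J :: "'n set"
    and a :: "'n \<Rightarrow> real" and \<alpha> :: real
  assumes v_nonneg: "\<And>i. 0 \<le> v $ i"
    and v_incr: "\<And>i j. i < j \<Longrightarrow> v $ i < v $ j"
    and J_card: "1 \<le> card J" "card J + 4 \<le> CARD('n)"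
    and a_nonzero: "\<And>j. j \<in> J \<Longrightarrow> a j \<noteq> 0"
    and undominated_ge:
      "\<And>x. undominated v J {j \<in> J. a j > 0} {j \<in> J. a j < 0} x \<Longrightarrow> (\<Sum>j\<in>J. a j * x $ j) \<ge> \<alpha>"
    and tight:
      "\<exists>T. T \<subseteq> {x. J_circuit v J x \<and> (\<Sum>j\<in>J. a j * x $ j) = \<alpha>} \<and>
           card T \<ge> card J \<and> \<not> affine_dependent T"
  shows "defines_facet (\<lambda>x. \<Sum>j\<in>J. a j * x $ j) \<alpha> (circuit_polytope v)"
proof -
  let ?P = "circuit_polytope v" and ?s = "\<Sum>i\<in>UNIV. v $ i"
  have v_inj: "inj (\<lambda>i. v $ i)"
    using v_incr by (auto intro!: injI) (metis less_irrefl neqE)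
  define w :: "(real, 'n) vec" where "w = (\<chi> j. if j \<in> J then a j else 0)"
  have w: "w \<bullet> x = (\<Sum>j\<in>J. a j * x $ j)" for x
  proof -
    have "w \<bullet> x = (\<Sum>j\<in>UNIV. if j \<in> J then a j * x $ j else 0)"
      unfolding w_def inner_vec_def by (rule sum.cong) auto
    then show ?thesis by (simp add: sum.If_cases)
  qed
  have J_proper: "J \<noteq> UNIV" using J_card(2) by auto
  obtain j0 where j0: "j0 \<in> J" using J_card(1) by fastforce
  define circ :: "('n \<Rightarrow> 'n) \<Rightarrow> (real, 'n) vec" where "circ \<sigma> = (\<chi> i. v $ \<sigma> i)" for \<sigma>
  have circ_in: "circ \<sigma> \<in> ?P" if "\<sigma> permutes UNIV" "cyclic_on \<sigma> UNIV" for \<sigma>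
    unfolding circuit_polytope_def
    by (rule hull_inc) (use that in \<open>auto simp: circuit_def circ_def\<close>)
  have circ_inner: "c \<bullet> circ \<sigma> = (\<Sum>i\<in>UNIV. c $ i * v $ \<sigma> i)" for c \<sigma>
    by (simp add: circ_def inner_vec_def)
  have circ_restrict: "c \<bullet> circ \<sigma> = c \<bullet> tuple_vec v J \<tau>"
    if "\<forall>j. j \<notin> J \<longrightarrow> c $ j = 0" "\<forall>j\<in>J. \<sigma> j = \<tau> j" for c \<sigma> \<tau>
    unfolding inner_vec_def by (rule sum.cong) (use that in \<open>auto simp: circ_def tuple_vec_def\<close>)
  have w_off: "\<forall>j. j \<notin> J \<longrightarrow> w $ j = 0" by (simp add: w_def)
  have J_bound: "w \<bullet> x \<ge> \<alpha>" if "J_circuit v J x" for x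
    unfolding w
    by (rule undominated_bound_imp_J_circuit_bound[OF _ _ that], erule a_nonzero, erule undominated_ge)
  have valid: "w \<bullet> x \<ge> \<alpha>" if "x \<in> ?P" for x
  proof -
    have "?P \<subseteq> {x. w \<bullet> x \<ge> \<alpha>}"
      unfolding circuit_polytope_def
    proof (rule hull_minimal)
      show "{x. circuit v x} \<subseteq> {x. w \<bullet> x \<ge> \<alpha>}"
      proof
        fix x assume "x \<in> {x. circuit v x}"
        then obtain \<sigma> where \<sigma>: "\<sigma> permutes UNIV" "cyclic_on \<sigma> UNIV" "x = circ \<sigma>"
          unfolding circuit_def circ_def by (auto simp: vec_eq_iff)
        have "J_circuit v J (tuple_vec v J \<sigma>)"
          using cyclic_imp_acyclic_on[OF \<sigma>(2) J_proper]
            inj_on_subset[OF permutes_inj[OF \<sigma>(1)] subset_UNIV]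
          by (simp add: J_circuit_tuple_vec[OF v_inj])
        then have "w \<bullet> tuple_vec v J \<sigma> \<ge> \<alpha>" by (rule J_bound)
        then show "x \<in> {x. w \<bullet> x \<ge> \<alpha>}" using circ_restrict[OF w_off, of \<sigma> \<sigma>] \<sigma>(3) by simp
      qed
    qed (rule convex_halfspace_ge)
    then show ?thesis using that by blast
  qed
  obtain T where T: "T \<subseteq> {x. J_circuit v J x \<and> w \<bullet> x = \<alpha>}" "card J \<le> card T" "\<not> affine_dependent T"
    using tight w by auto
  then have "T \<noteq> {}" using J_card(1) by auto
  then obtain t0 where t0: "t0 \<in> T" by blast
  have T_tuple: "\<exists>\<tau>. t = tuple_vec v J \<tau> \<and> inj_on \<tau> J \<and> acyclic_on \<tau> J" if "t \<in> T" for t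
  proof -
    have t: "J_circuit v J t" using T(1) that by blast
    then obtain \<tau> where "t = tuple_vec v J \<tau>" by (rule J_circuit_imp_tuple_vec)
    then show ?thesis using t J_circuit_tuple_vec[OF v_inj, of J \<tau>] by auto
  qed
  have tight_ext: "w \<bullet> circ \<sigma> = \<alpha>" if "t \<in> T" "t = tuple_vec v J \<tau>" "\<forall>j\<in>J. \<sigma> j = \<tau> j" for t \<tau> \<sigma>
    using T(1) that circ_restrict[OF w_off that(3)] by auto
  have nonempty: "{x \<in> ?P. w \<bullet> x = \<alpha>} \<noteq> {}"
  proof -
    obtain \<tau> where \<tau>: "t0 = tuple_vec v J \<tau>" "inj_on \<tau> J" "acyclic_on \<tau> J" using T_tuple[OF t0] by blast
    obtain \<sigma> where \<sigma>: "\<sigma> permutes UNIV" "cyclic_on \<sigma> UNIV" "\<forall>j\<in>J. \<sigma> j = \<tau> j"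
      using circuit_extension_exists[OF \<tau>(2,3)] by metis
    then have "circ \<sigma> \<in> {x \<in> ?P. w \<bullet> x = \<alpha>}"
      using circ_in[OF \<sigma>(1,2)] tight_ext[OF t0 \<tau>(1) \<sigma>(3)] by simp
    then show ?thesis by blast
  qed
  \<comment> \<open>If every circuit were tight, \<open>w\<close> would be constant on the circuits extending the empty partial
    circuit, so its coefficient at \<open>j0\<close> would agree with its zero coefficients off \<open>J\<close>.\<close>
  have "\<exists>p\<in>?P. w \<bullet> p \<noteq> \<alpha>"
  proof (rule ccontr)
    assume "\<not> (\<exists>p\<in>?P. w \<bullet> p \<noteq> \<alpha>)"
    then have all_tight: "w \<bullet> x = \<alpha>" if "x \<in> ?P" for x using that by blast
    obtain k where k: "k \<notin> J" using J_proper by blast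
    have "w $ j0 = w $ k"
    proof (rule functional_constant_on_extensions[where J = "{}" and \<tau> = id])
      show "acyclic_on id {}" by (simp add: acyclic_on_def)
      show "card ({} :: 'n set) + 4 \<le> CARD('n)" using J_card by simp
      show "(\<Sum>i\<in>UNIV. w $ i * v $ \<sigma> i) = \<alpha>" if "\<sigma> permutes UNIV" "cyclic_on \<sigma> UNIV" for \<sigma>
        using all_tight[OF circ_in[OF that]] circ_inner by simp
    qed (use v_inj in auto)
    then show False using a_nonzero[OF j0] j0 k by (simp add: w_def)
  qed
  then obtain p where p: "p \<in> ?P" "w \<bullet> p \<noteq> \<alpha>" by blast
  have "{x \<in> ?P. w \<bullet> x = \<alpha>} facet_of ?P"
  proof (rule facet_by_functionals[OF _ valid nonempty p])
    show "convex ?P" by (simp add: circuit_polytope_def)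
  next
    fix c :: "(real, 'n) vec" and \<gamma> assume const: "\<And>x. x \<in> ?P \<Longrightarrow> w \<bullet> x = \<alpha> \<Longrightarrow> c \<bullet> x = \<gamma>"
    obtain k where k: "k \<notin> J" using J_proper by blast
    have c_off: "c $ i = c $ k" if "i \<notin> J" for i
    proof -
      obtain \<tau> where \<tau>: "t0 = tuple_vec v J \<tau>" "inj_on \<tau> J" "acyclic_on \<tau> J" using T_tuple[OF t0] by blast
      show ?thesis
      proof (rule functional_constant_on_extensions[OF \<tau>(2,3) J_card(2) v_inj _ that k])
        fix \<sigma> assume \<sigma>: "\<sigma> permutes UNIV" "cyclic_on \<sigma> UNIV" "\<forall>j\<in>J. \<sigma> j = \<tau> j"
        show "(\<Sum>i\<in>UNIV. c $ i * v $ \<sigma> i) = \<gamma>"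
          using const[OF circ_in[OF \<sigma>(1,2)] tight_ext[OF t0 \<tau>(1) \<sigma>(3)]] circ_inner by simp
      qed
    qed
    \<comment> \<open>Normalised to vanish off \<open>J\<close>, the functional can be evaluated on the tuples themselves.\<close>
    define c' where "c' = c - c $ k *\<^sub>R (\<chi> i. 1)"
    have c'_off: "\<forall>j. j \<notin> J \<longrightarrow> c' $ j = 0" using c_off by (simp add: c'_def)
    have c'_P: "c' \<bullet> x = c \<bullet> x - c $ k * ?s" if "x \<in> ?P" for x
    proof -
      have "(\<chi> i. 1) \<bullet> x = ?s" using sum_circuit_polytope[OF that] by (simp add: inner_vec_def)
      then show ?thesis by (simp only: c'_def inner_diff_left inner_scaleR_left)
    qed
    have c'_T: "c' \<bullet> t = \<gamma> - c $ k * ?s" if tT: "t \<in> T" for t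
    proof -
      obtain \<tau> where \<tau>: "t = tuple_vec v J \<tau>" "inj_on \<tau> J" "acyclic_on \<tau> J" using T_tuple[OF tT] by blast
      obtain \<sigma> where \<sigma>: "\<sigma> permutes UNIV" "cyclic_on \<sigma> UNIV" "\<forall>j\<in>J. \<sigma> j = \<tau> j"
        using circuit_extension_exists[OF \<tau>(2,3)] by metis
      have "c' \<bullet> t = c' \<bullet> circ \<sigma>" using circ_restrict[OF c'_off \<sigma>(3)] \<tau>(1) by simp
      also have "\<dots> = \<gamma> - c $ k * ?s"
        using c'_P[OF circ_in[OF \<sigma>(1,2)]] const[OF circ_in[OF \<sigma>(1,2)] tight_ext[OF tT \<tau>(1) \<sigma>(3)]] by simp
      finally show ?thesis .
    qed
    let ?V = "{x :: (real, 'n) vec. \<forall>j. j \<notin> J \<longrightarrow> x $ j = 0}"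
    have "\<exists>l. c' = l *\<^sub>R w"
    proof (rule functional_proportional[where V = ?V and T = T])
      show "subspace ?V" by (auto simp: subspace_def)
      show "dim ?V \<le> card T" using dim_substandard_cart[of J, where 'a = real] T(2) by (simp add: dim_vec_eq)
      show "T \<subseteq> ?V" using T_tuple by (fastforce simp: tuple_vec_def)
      show "w \<noteq> 0" using a_nonzero[OF j0] j0 by (auto simp: w_def vec_eq_iff)
      show "w \<bullet> t = \<alpha>" if "t \<in> T" for t using T(1) that by blast
      show "w \<in> ?V" "c' \<in> ?V" using w_off c'_off by simp_all
    qed (rule T(3) t0 c'_T, assumption?)+
    then obtain l where l: "c' = l *\<^sub>R w" by blast
    obtain x0 where x0: "x0 \<in> ?P" "w \<bullet> x0 = \<alpha>" using nonempty by blast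
    have "l * \<alpha> = \<gamma> - c $ k * ?s" using c'_P[OF x0(1)] const[OF x0] l x0(2) by simp
    then have "c \<bullet> x - \<gamma> = l * (w \<bullet> x - \<alpha>)" if "x \<in> ?P" for x
      using c'_P[OF that] l by (simp add: algebra_simps)
    then show "\<exists>l. \<forall>x\<in>?P. c \<bullet> x - \<gamma> = l * (w \<bullet> x - \<alpha>)" by blast
  qed
  then show ?thesis using valid by (simp add: defines_facet_def w)
qed

end
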